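(* There exists $\sigma_0>0$ such that for every $\sigma\in(0,\sigma_0)$ and all pairs of integers $(m,n)\ne(m',n')$ with $0\le m\le n$ and $0\le m'\le n'$, one has $\Lambda_{m,n}(\sigma)\neq\Lambda_{m',n'}(\sigma)$. (That is, for small $\sigma>0$ the Robin spectrum of the equilateral triangle has no multiplicities besides the systematic doubling $\Lambda_{m,n}=\Lambda_{n,m}$.)
   Context: Fix $r>0$ (the inradius of an equilateral triangle $T$). For integers $m,n\ge0$ and $\sigma\ge0$, let $(L,M,N)$ with $L\in(-\pi/2,0]$ and $M,N\in[0,\pi/2)$ be the unique solution of the system $$\big(2L-M-N-(m+n)\pi\big)\tan L=3r\sigma,\quad \big(2M-N-L+m\pi\big)\tan M=3r\sigma,\quad \big(2N-L-M+n\pi\big)\tan N=3r\sigma .$$ Set $\mu=\frac{2M-N-L}{\pi}+m$, $\nu=\frac{2N-L-M}{\pi}+n$, and $\Lambda_{m,n}(\sigma)=\frac{4\pi^2}{27r^2}(\mu^2+\mu\nu+\nu^2)$. By McCartin's theorem the Robin spectrum of $T$ (problem $\Delta f+\lambda f=0$ in $T$, $\partial f/\partial n+\sigma f=0$ on $\partial T$) consists of the numbers $\Lambda_{m,n}(\sigma)$, $0\le m\le n$, with $\Lambda_{m,n}$ counted twice for $m<n$ (a symmetric and an antisymmetric eigenfunction) and once for $m=n$; the set $\{\Lambda_{m,n}(\sigma)\}_{0\le m\le n}$ is the desymmetrized spectrum. *)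

theory Defs
  imports Complex_Main
begin

text \<open>The (unique, by McCartin) solution (L,M,N) of the transcendental system,
  with L in (-pi/2,0] and M,N in [0,pi/2).\<close>
definition robin_sys :: "real \<Rightarrow> nat \<Rightarrow> nat \<Rightarrow> real \<Rightarrow> real \<times> real \<times> real \<Rightarrow> bool" where
  "robin_sys r m n \<sigma> = (\<lambda>(L, M, N).
      -pi/2 < L \<and> L \<le> 0 \<and> 0 \<le> M \<and> M < pi/2 \<and> 0 \<le> N \<and> N < pi/2 \<and>
      (2*L - M - N - (real m + real n) * pi) * tan L = 3 * r * \<sigma> \<and>
      (2*M - N - L + real m * pi) * tan M = 3 * r * \<sigma> \<and>
      (2*N - L - M + real n * pi) * tan N = 3 * r * \<sigma>)"

definition robin_LMN :: "real \<Rightarrow> nat \<Rightarrow> nat \<Rightarrow> real \<Rightarrow> real \<times> real \<times> real" where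
  "robin_LMN r m n \<sigma> = (THE p. robin_sys r m n \<sigma> p)"

definition robin_Lambda :: "real \<Rightarrow> nat \<Rightarrow> nat \<Rightarrow> real \<Rightarrow> real" where
  "robin_Lambda r m n \<sigma> =
     (case robin_LMN r m n \<sigma> of (L, M, N) \<Rightarrow>
        let \<mu> = (2*M - N - L) / pi + real m;
            \<nu> = (2*N - L - M) / pi + real n
        in 4 * pi^2 / (27 * r^2) * (\<mu>^2 + \<mu>*\<nu> + \<nu>^2))"

end

(* Put k = 3 r \<sigma>, A = \<pi> \<mu>, B = \<pi> \<nu>. Then M = arctan (k/A), N = arctan (k/B), -L = arctan (k/(A+B)), so the
   system becomes a system for (A, B) that expresses (m \<pi>, n \<pi>) explicitly through (A, B). It is the
   critical point equation of a convex function of (M, N, -L) with logarithmic barriers, which gives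
   existence and uniqueness. Moreover A^2 + AB + B^2 = \<pi>^2 (m^2 + mn + n^2) + 3 G(A, B) with an explicit
   G (robin_shift below) satisfying 0 \<le> G \<le> 3k, so for small k equal eigenvalues have equal
   m^2 + mn + n^2 and equal G.
   The case m = 0 is separated from m \<ge> 1 by the first order of G. For m \<ge> 1, on a level curve of
   A^2 + AB + B^2 the function G is strictly increasing in P = AB(A+B), and P determines A \<le> B there.
   For the monotonicity let u, w, t be the squares of A, B, A+B: their first two elementary symmetric
   functions are constant on the level curve and the third one is P^2. Differentiating in k turns the
   sums over arctan into sums of rational functions of u, w, t. *)
theory Submission
  imports Defs "HOL-Analysis.Elementary_Topology"
begin

section \<open>Symmetric rational sums as functions of the third elementary symmetric
  function\<close>

lemma cubic_shift:
  fixes u w t a :: real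
  shows "(u + a) * (w + a) * (t + a) =
    u*w*t + (u*w + u*t + w*t) * a + (u + w + t) * a^2 + a^3"
  by (simp add: algebra_simps power2_eq_square power3_eq_cube)

text \<open>The sum is the logarithmic derivative in \<open>a\<close> of the shifted cubic, so the
  numerator is free of \<open>u*w*t\<close>.\<close>

lemma sum_inverse_shift:
  fixes u w t a :: real
  assumes "u > 0" "w > 0" "t > 0" "a \<ge> 0"
  shows "1/(u+a) + 1/(w+a) + 1/(t+a) =
    (u*w + u*t + w*t + 2*(u+w+t)*a + 3*a^2) / ((u+a)*(w+a)*(t+a))"
proof -
  have "u+a \<noteq> 0" "w+a \<noteq> 0" "t+a \<noteq> 0" using assms by auto
  then show ?thesis by (simp add: divide_simps) (simp add: algebra_simps power2_eq_square)
qed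

text \<open>Since x/(x+a) = 1 - a/(x+a), it suffices to compare the sums of 1/(x+a): their
  numerators agree and the denominators are ordered by the products.\<close>

lemma sum_resolvent_mono:
  fixes u w t u' w' t' a :: real
  assumes pos: "u > 0" "w > 0" "t > 0" "u' > 0" "w' > 0" "t' > 0"
    and e1: "u + w + t = u' + w' + t'" and e2: "u*w + u*t + w*t = u'*w' + u'*t' + w'*t'"
    and e3: "u*w*t \<le> u'*w'*t'" and a: "a \<ge> 0"
  shows "u/(u+a) + w/(w+a) + t/(t+a) \<le> u'/(u'+a) + w'/(w'+a) + t'/(t'+a)"
proof -
  have split: "x/(x+a) = 1 - a * (1/(x+a))" if "x > 0" for x :: real
    using that a by (simp add: field_simps)
  have "1/(u'+a) + 1/(w'+a) + 1/(t'+a) \<le> 1/(u+a) + 1/(w+a) + 1/(t+a)"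
    unfolding sum_inverse_shift[OF pos(1-3) a] sum_inverse_shift[OF pos(4-6) a] e1 e2
  proof (rule divide_left_mono)
    show "(u+a)*(w+a)*(t+a) \<le> (u'+a)*(w'+a)*(t'+a)"
      unfolding cubic_shift e1 e2 using e3 by simp
  qed (use pos a in auto)
  from mult_left_mono[OF this a] show ?thesis
    using pos by (simp only: split) (simp only: distrib_left)
qed

text \<open>The numerator is affine in \<open>e3\<close>, and \<open>e3\<close> only translates the
  two denominator factors. With \<open>e1\<close> and \<open>e2\<close> fixed the sum is thus an
  explicit function of \<open>e3\<close>.\<close>

lemma sum_double_resolvent:
  fixes u w t a b :: real
  defines "e1 \<equiv> u + w + t" and "e2 \<equiv> u*w + u*t + w*t" and "e3 \<equiv> u*w*t"
  assumes pos: "u > 0" "w > 0" "t > 0" "a \<ge> 0" "b \<ge> 0"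
  shows "u/((u+a)*(u+b)) + w/((w+a)*(w+b)) + t/((t+a)*(t+b)) =
    ((e2 + 2*(a+b)*e1 + 3*(a+b)^2 - 3*(a*b)) * e3 + a*b*(e1*e2 + 2*(a+b)*e2 + a*b*e1)) /
    ((e3 + (e2*a + e1*a^2 + a^3)) * (e3 + (e2*b + e1*b^2 + b^3)))"
proof -
  let ?D = "((u+a)*(w+a)*(t+a)) * ((u+b)*(w+b)*(t+b))"
  have nz: "u+a \<noteq> 0" "w+a \<noteq> 0" "t+a \<noteq> 0" "u+b \<noteq> 0" "w+b \<noteq> 0" "t+b \<noteq> 0"
    using pos by auto
  have "u/((u+a)*(u+b)) = u*((w+a)*(w+b)*((t+a)*(t+b))) / ?D"
       "w/((w+a)*(w+b)) = w*((u+a)*(u+b)*((t+a)*(t+b))) / ?D"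
       "t/((t+a)*(t+b)) = t*((u+a)*(u+b)*((w+a)*(w+b))) / ?D"
    using nz by (simp_all add: divide_simps)
  then have "u/((u+a)*(u+b)) + w/((w+a)*(w+b)) + t/((t+a)*(t+b)) =
     (u*((w+a)*(w+b)*((t+a)*(t+b))) + w*((u+a)*(u+b)*((t+a)*(t+b)))
      + t*((u+a)*(u+b)*((w+a)*(w+b)))) / ?D"
    by (simp only: add_divide_distrib)
  also have "u*((w+a)*(w+b)*((t+a)*(t+b))) + w*((u+a)*(u+b)*((t+a)*(t+b)))
      + t*((u+a)*(u+b)*((w+a)*(w+b))) =
      (e2 + 2*(a+b)*e1 + 3*(a+b)^2 - 3*(a*b)) * e3 + a*b*(e1*e2 + 2*(a+b)*e2 + a*b*e1)"
    unfolding e1_def e2_def e3_def by algebra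
  also have "?D = (e3 + (e2*a + e1*a^2 + a^3)) * (e3 + (e2*b + e1*b^2 + b^3))"
    unfolding cubic_shift e1_def e2_def e3_def by (simp only: add.assoc)
  finally show ?thesis .
qed

text \<open>The left side is the excess of the shifted cubic over \<open>u*w*t\<close>. Each factor
  grows by at most 1/100 of itself, and 1.01^3 < 1.1.\<close>

lemma shift_defect_bound:
  fixes u w t a :: real
  assumes "u \<ge> 1" "w \<ge> 1" "t \<ge> 1" "0 \<le> a" "a \<le> 1/100"
  shows "(u*w + u*t + w*t)*a + (u+w+t)*a^2 + a^3 \<le> u*w*t / 10"
proof -
  have s: "x + a \<le> 101/100 * x" if "x \<ge> 1" for x using that assms by simp
  have "(u+a)*(w+a)*(t+a) \<le> (101/100*u)*(101/100*w)*(101/100*t)"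
    using assms s by (intro mult_mono) auto
  also have "\<dots> \<le> (11/10) * (u*w*t)"
    using assms by (simp add: mult_nonneg_nonneg)
  finally show ?thesis unfolding cubic_shift by linarith
qed

text \<open>At a = b = 0 each summand is 1/u, and the difference is the left side without the factor
  1/2; that factor absorbs the effect of shifts up to 1/100. The explicit gap later outweighs a
  competing term.\<close>

lemma double_resolvent_gap:
  fixes u w t u' w' t' a b :: real
  assumes ge: "u \<ge> 1" "w \<ge> 1" "t \<ge> 1" "u' \<ge> 1" "w' \<ge> 1" "t' \<ge> 1"
    and e1: "u + w + t = u' + w' + t'" and e2: "u*w + u*t + w*t = u'*w' + u'*t' + w'*t'"
    and e3: "u*w*t \<le> u'*w'*t'" and a: "0 \<le> a" "a \<le> 1/100" and b: "0 \<le> b" "b \<le> 1/100"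
  shows "(u*w + u*t + w*t) * (1/(u*w*t) - 1/(u'*w'*t')) / 2
    \<le> (u/((u+a)*(u+b)) + w/((w+a)*(w+b)) + t/((t+a)*(t+b)))
      - (u'/((u'+a)*(u'+b)) + w'/((w'+a)*(w'+b)) + t'/((t'+a)*(t'+b)))"
proof -
  define s1 where "s1 = u + w + t"
  define s2 where "s2 = u*w + u*t + w*t"
  define e where "e = u*w*t"
  define e' where "e' = u'*w'*t'"
  define da where "da = s2*a + s1*a^2 + a^3"
  define db where "db = s2*b + s1*b^2 + b^3"
  define al where "al = s2 + 2*(a+b)*s1 + 3*(a+b)^2 - 3*(a*b)"
  define be where "be = a*b*(s1*s2 + 2*(a+b)*s2 + a*b*s1)"
  have s: "s1 > 0" "s2 > 0" "e > 0" "e' > 0" "e \<le> e'"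
    using ge e3 by (auto simp: s1_def s2_def e_def e'_def intro!: add_pos_pos mult_pos_pos)
  have da: "0 \<le> da" "da \<le> e/10" and db: "0 \<le> db" "db \<le> e/10"
    using shift_defect_bound[OF ge(1-3) a] shift_defect_bound[OF ge(1-3) b] s a b
    by (auto simp: da_def db_def s1_def[symmetric] s2_def[symmetric] e_def[symmetric])
  have da': "da \<le> e'/10" and db': "db \<le> e'/10" using da db s by auto
  have "3*(a+b)^2 - 3*(a*b) = 3*(a^2 + b^2 + a*b)" by (simp add: power2_eq_square algebra_simps)
  then have al: "al \<ge> s2" unfolding al_def using a b s
    by (smt (verit) mult_nonneg_nonneg zero_le_power2)
  have be: "be \<ge> 0" unfolding be_def using a b s by simp
  have pos: "e + da > 0" "e + db > 0" "e' + da > 0" "e' + db > 0" using s da db by auto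
  have L: "u/((u+a)*(u+b)) + w/((w+a)*(w+b)) + t/((t+a)*(t+b)) = (al*e + be)/((e+da)*(e+db))"
    using sum_double_resolvent[of u w t a b] ge a b
    unfolding al_def be_def da_def db_def s1_def s2_def e_def by simp
  have R: "u'/((u'+a)*(u'+b)) + w'/((w'+a)*(w'+b)) + t'/((t'+a)*(t'+b)) =
      (al*e' + be)/((e'+da)*(e'+db))"
    using sum_double_resolvent[of u' w' t' a b] ge a b
    unfolding al_def be_def da_def db_def s1_def s2_def e'_def e1 e2 by simp
  \<comment> \<open>In the part multiplied by \<open>al\<close> the terms linear in
    \<open>da\<close> and \<open>db\<close> cancel, so \<open>e' - e\<close> factors out with a
    positive cofactor.\<close>
  have D: "(al*e + be)/((e+da)*(e+db)) - (al*e' + be)/((e'+da)*(e'+db)) =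
     (e' - e) * ((al*(e*e' - da*db) + be*(e + e' + da + db)) / ((e+da)*(e+db)*((e'+da)*(e'+db))))"
    using pos by (simp add: diff_frac_eq) (simp add: algebra_simps)
  have "(e+da)*(e+db)*((e'+da)*(e'+db)) \<le> (11/10*e)*(11/10*e)*((11/10*e')*(11/10*e'))"
    using s da db da' db' pos by (intro mult_mono mult_nonneg_nonneg) auto
  then have den: "(e+da)*(e+db)*((e'+da)*(e'+db)) \<le> 3/2*(e*e')*(e*e')"
  proof -
    have "0 \<le> (e*e')*(e*e')" by simp
    then show ?thesis using \<open>(e+da)*(e+db)*((e'+da)*(e'+db)) \<le> _\<close> by (simp add: algebra_simps)
  qed
  have "da*db \<le> (e/10)*(e'/10)" using s da db db' by (intro mult_mono) auto
  then have dd: "99/100*(e*e') \<le> e*e' - da*db" by (simp add: mult.commute)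
  have "s2 * (99/100*(e*e')) \<le> al*(e*e' - da*db)"
    using dd al s by (intro mult_mono) auto
  moreover have "be*(e + e' + da + db) \<ge> 0" using be s da db by simp
  ultimately have num: "s2*(99/100*(e*e')) \<le> al*(e*e' - da*db) + be*(e + e' + da + db)" by simp
  \<comment> \<open>The constants fit: (11/10)^4 < 3/2 and (99/100)/(3/2) > 1/2.\<close>
  have "s2 / (e*e') / 2 \<le> s2*(99/100*(e*e')) / (3/2*(e*e')*(e*e'))"
    using s by (simp add: field_simps)
  also have "\<dots> \<le> (al*(e*e' - da*db) + be*(e + e' + da + db)) / ((e+da)*(e+db)*((e'+da)*(e'+db)))"
    using num den s pos order_trans[OF _ num, of 0] by (intro frac_le mult_pos_pos) auto
  finally have "(e' - e) * (s2/(e*e')/2) \<le> (e' - e) * ((al*(e*e' - da*db) + be*(e + e' + da + db)) / ((e+da)*(e+db)*((e'+da)*(e'+db))))"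
    using s by (intro mult_left_mono) auto
  moreover have "s2 * (1/e - 1/e') / 2 = (e' - e) * (s2/(e*e')/2)" using s by (simp add: field_simps)
  ultimately show ?thesis
    unfolding L R D s2_def[symmetric] e_def[symmetric] e'_def[symmetric] by simp
qed

section \<open>Integration in k: from rational sums to sums over arctan\<close>

lemma has_derivative_nonneg_imp_nonneg:
  fixes g g' :: "real \<Rightarrow> real"
  assumes "\<And>x. 0 \<le> x \<Longrightarrow> x \<le> s \<Longrightarrow> (g has_real_derivative g' x) (at x)"
    and "\<And>x. 0 \<le> x \<Longrightarrow> x \<le> s \<Longrightarrow> 0 \<le> g' x" and "g 0 = 0" and "0 \<le> s"
  shows "0 \<le> g s"
  using DERIV_nonneg_imp_nondecreasing[of 0 s g] assms by metis

lemma has_real_derivative_arctan_divide: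
  fixes s x :: real
  assumes "x > 0"
  shows "((\<lambda>s. arctan (s / x)) has_real_derivative x / (x\<^sup>2 + s\<^sup>2)) (at s)"
proof -
  have "x\<^sup>2 + s\<^sup>2 > 0" using assms by (simp add: add_pos_nonneg)
  then have "1 + (s/x)\<^sup>2 = (x\<^sup>2 + s\<^sup>2) / x\<^sup>2" using assms by (simp add: field_simps)
  with assms show ?thesis
    by (auto intro!: derivative_eq_intros simp: power2_eq_square)
qed

text \<open>Both sides vanish at k = 0, and the k-derivative of x arctan(k/x) is u/(u + k^2) with u
  = x^2, which \<open>sum_resolvent_mono\<close> compares.\<close>

lemma sum_arctan_mono:
  fixes x y z x' y' z' k :: real
  assumes pos: "x > 0" "y > 0" "z > 0" "x' > 0" "y' > 0" "z' > 0"
    and e1: "x\<^sup>2 + y\<^sup>2 + z\<^sup>2 = x'\<^sup>2 + y'\<^sup>2 + z'\<^sup>2"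
    and e2: "x\<^sup>2*y\<^sup>2 + x\<^sup>2*z\<^sup>2 + y\<^sup>2*z\<^sup>2 = x'\<^sup>2*y'\<^sup>2 + x'\<^sup>2*z'\<^sup>2 + y'\<^sup>2*z'\<^sup>2"
    and e3: "x\<^sup>2*y\<^sup>2*z\<^sup>2 \<le> x'\<^sup>2*y'\<^sup>2*z'\<^sup>2" and k: "k \<ge> 0"
  shows "x*arctan (k/x) + y*arctan (k/y) + z*arctan (k/z)
    \<le> x'*arctan (k/x') + y'*arctan (k/y') + z'*arctan (k/z')"
proof -
  let ?R = "\<lambda>x s::real. x\<^sup>2 / (x\<^sup>2 + s\<^sup>2)"
  have d: "((\<lambda>s. x * arctan (s / x)) has_real_derivative ?R x s) (at s)" if "x > 0" for x s :: real
    using DERIV_cmult[OF has_real_derivative_arctan_divide[OF that], of x s]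
    by (simp add: power2_eq_square)
  let ?g = "\<lambda>s. (x'*arctan (s/x') + y'*arctan (s/y') + z'*arctan (s/z'))
    - (x*arctan (s/x) + y*arctan (s/y) + z*arctan (s/z))"
  have "0 \<le> ?g k"
  proof (rule has_derivative_nonneg_imp_nonneg[where g = ?g and s = k and g' =
      "\<lambda>s. (?R x' s + ?R y' s + ?R z' s) - (?R x s + ?R y s + ?R z s)"])
    show "0 \<le> (?R x' s + ?R y' s + ?R z' s) - (?R x s + ?R y s + ?R z s)" for s
      using sum_resolvent_mono[of "x\<^sup>2" "y\<^sup>2" "z\<^sup>2" "x'\<^sup>2" "y'\<^sup>2" "z'\<^sup>2" "s\<^sup>2"] pos e1 e2 e3
      by simp
  qed (use d pos k in \<open>auto intro!: DERIV_diff DERIV_add\<close>)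
  then show ?thesis by simp
qed

text \<open>Two integrations from 0. The k-derivative of arctan(k/x)^2 is 2x arctan(k/x)/(x^2 +
  k^2); freezing k^2 in the denominator as a constant \<open>b\<close> and differentiating the
  remaining arctan gives the double resolvent with a = s^2. Its gap \<open>c\<close> integrates to c
  s and then to c k^2.\<close>

lemma sum_arctan_squared_gap:
  fixes x y z x' y' z' k :: real
  assumes ge: "x \<ge> 1" "y \<ge> 1" "z \<ge> 1" "x' \<ge> 1" "y' \<ge> 1" "z' \<ge> 1"
    and e1: "x\<^sup>2 + y\<^sup>2 + z\<^sup>2 = x'\<^sup>2 + y'\<^sup>2 + z'\<^sup>2"
    and e2: "x\<^sup>2*y\<^sup>2 + x\<^sup>2*z\<^sup>2 + y\<^sup>2*z\<^sup>2 = x'\<^sup>2*y'\<^sup>2 + x'\<^sup>2*z'\<^sup>2 + y'\<^sup>2*z'\<^sup>2"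
    and e3: "x\<^sup>2*y\<^sup>2*z\<^sup>2 \<le> x'\<^sup>2*y'\<^sup>2*z'\<^sup>2" and k: "0 \<le> k" "k \<le> 1/10"
  defines "c \<equiv> (x\<^sup>2*y\<^sup>2 + x\<^sup>2*z\<^sup>2 + y\<^sup>2*z\<^sup>2) * (1/(x\<^sup>2*y\<^sup>2*z\<^sup>2) - 1/(x'\<^sup>2*y'\<^sup>2*z'\<^sup>2)) / 2"
  shows "c * k\<^sup>2 \<le> ((arctan (k/x))\<^sup>2 + (arctan (k/y))\<^sup>2 + (arctan (k/z))\<^sup>2)
    - ((arctan (k/x'))\<^sup>2 + (arctan (k/y'))\<^sup>2 + (arctan (k/z'))\<^sup>2)"
proof -
  have pos: "x > 0" "y > 0" "z > 0" "x' > 0" "y' > 0" "z' > 0" using ge by auto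
  let ?R = "\<lambda>b x s::real. x\<^sup>2 / ((x\<^sup>2 + s\<^sup>2) * (x\<^sup>2 + b))"
  let ?H = "\<lambda>b x s::real. x * arctan (s/x) / (x\<^sup>2 + b)"
  have sq: "0 \<le> s\<^sup>2 \<and> s\<^sup>2 \<le> 1/100" if "0 \<le> s" "s \<le> k" for s :: real
    using power_mono[of s "1/10" 2] that k by (simp add: power2_eq_square)
  have d: "(?H b x has_real_derivative ?R b x s) (at s)" if "x > 0" for x s b :: real
    using DERIV_cmult[OF has_real_derivative_arctan_divide[OF that], of "x / (x\<^sup>2+b)" s]
    by (simp add: power2_eq_square mult.commute)
  let ?g = "\<lambda>b s. (?H b x s + ?H b y s + ?H b z s) - (?H b x' s + ?H b y' s + ?H b z' s) - c * s"
  have W: "0 \<le> ?g b s"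
    if b: "0 \<le> b" "b \<le> 1/100" and s: "0 \<le> s" "s \<le> k" for b s
  proof (rule has_derivative_nonneg_imp_nonneg[where g = "?g b" and s = s and g' =
      "\<lambda>s. (?R b x s + ?R b y s + ?R b z s) - (?R b x' s + ?R b y' s + ?R b z' s) - c"])
    show "0 \<le> (?R b x w + ?R b y w + ?R b z w) - (?R b x' w + ?R b y' w + ?R b z' w) - c"
      if "0 \<le> w" "w \<le> s" for w
      using double_resolvent_gap[of "x\<^sup>2" "y\<^sup>2" "z\<^sup>2" "x'\<^sup>2" "y'\<^sup>2" "z'\<^sup>2" "w\<^sup>2" b] e1 e2 e3 ge b s sq[of w] that
      unfolding c_def by simp
  qed (use d pos k s in \<open>auto intro!: DERIV_diff DERIV_add DERIV_cmult_Id\<close>)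
  let ?T = "\<lambda>x k::real. 2 * (?H (k\<^sup>2) x k)"
  have d2: "((\<lambda>k. (arctan (k/x))\<^sup>2) has_real_derivative ?T x k) (at k)" if "x > 0" for x k :: real
    using DERIV_power[OF has_real_derivative_arctan_divide[OF that], of 2 k] by (simp add: mult_ac)
  let ?h = "\<lambda>k. (((arctan (k/x))\<^sup>2 + (arctan (k/y))\<^sup>2 + (arctan (k/z))\<^sup>2)
    - ((arctan (k/x'))\<^sup>2 + (arctan (k/y'))\<^sup>2 + (arctan (k/z'))\<^sup>2)) - c * k\<^sup>2"
  have "0 \<le> ?h k"
  proof (rule has_derivative_nonneg_imp_nonneg[where g = ?h and s = k and g' =
      "\<lambda>k. ((?T x k + ?T y k + ?T z k) - (?T x' k + ?T y' k + ?T z' k)) - c * (2*k)"])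
    show "0 \<le> ((?T x s + ?T y s + ?T z s) - (?T x' s + ?T y' s + ?T z' s)) - c * (2*s)"
      if "0 \<le> s" "s \<le> k" for s
    proof -
      have "0 \<le> ?g (s\<^sup>2) s" using W[of "s\<^sup>2" s] sq[OF that] that by simp
      then show ?thesis by linarith
    qed
    show "(?h has_real_derivative ((?T x s + ?T y s + ?T z s) - (?T x' s + ?T y' s + ?T z' s)) - c * (2*s)) (at s)" for s
      using pos by (intro DERIV_diff DERIV_add d2) (auto intro!: derivative_eq_intros)
  qed (use k in auto)
  then show ?thesis by simp
qed

section \<open>Monotonicity of the shift along level curves\<close>

text \<open>The tangent addition formula applied twice. The right side depends on x and y only
  through x^2 + xy + y^2 and xy(x+y), so on a level curve it is a function of the latter.\<close>

lemma arctan_sum_zero_sum: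
  fixes x y k :: real
  assumes "x \<ge> 1" "y \<ge> 1" "0 < k" "k \<le> 1/10"
  shows "arctan (k/x) + arctan (k/y) - arctan (k/(x+y))
    = arctan (k * (x\<^sup>2 + x*y + y\<^sup>2 + k\<^sup>2) / (x*y*(x+y)))"
proof -
  have k2: "k\<^sup>2 \<le> 1/100" using power_mono[of k "1/10" 2] assms by (simp add: power2_eq_square)
  have xy: "x*y \<ge> x" "x*y \<ge> y" "x*y \<ge> 1" using assms mult_mono[of 1 x 1 y]
    by (auto simp: mult_le_cancel_left1 mult_le_cancel_right1)
  have p: "x*y - k\<^sup>2 > 0" using k2 xy by linarith
  have kz: "k*(x+y) < x*y - k\<^sup>2"
  proof -
    have "k*(x+y) \<le> 1/10*(x+y)" using assms by (intro mult_right_mono) auto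
    also have "\<dots> \<le> 2/10*(x*y)" using xy by simp
    finally show ?thesis using xy k2 by linarith
  qed
  define s where "s = k*(x+y) / (x*y - k\<^sup>2)"
  have s: "0 < s" "s < 1" using p kz assms by (auto simp: s_def)
  have "arctan (k/x) + arctan (k/y) = arctan ((k/x + k/y) / (1 - (k/x)*(k/y)))"
    using assms by (intro arctan_add) auto
  also have "(k/x + k/y) / (1 - (k/x)*(k/y)) = s"
    using assms p unfolding s_def by (simp add: divide_simps power2_eq_square) (simp add: algebra_simps)
  finally have 1: "arctan (k/x) + arctan (k/y) = arctan s" .
  have "arctan s + arctan (- (k/(x+y))) = arctan ((s + - (k/(x+y))) / (1 - s * (- (k/(x+y)))))"
    using s assms by (intro arctan_add) auto
  also have "(s + - (k/(x+y))) / (1 - s * (- (k/(x+y)))) = k * (x\<^sup>2 + x*y + y\<^sup>2 + k\<^sup>2) / (x*y*(x+y))"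
  proof -
    have z: "x + y > 0" "x > 0" "y > 0" using assms by auto
    have "s + - (k/(x+y)) = k * (x\<^sup>2 + x*y + y\<^sup>2 + k\<^sup>2) / ((x*y - k\<^sup>2)*(x+y))"
      using p z unfolding s_def by (simp add: divide_simps) (simp add: algebra_simps power2_eq_square)
    moreover have "1 - s * (- (k/(x+y))) = x*y / (x*y - k\<^sup>2)"
      using p z unfolding s_def by (simp add: divide_simps power2_eq_square)
    ultimately show ?thesis using p z by simp
  qed
  finally show ?thesis using 1 by (simp add: arctan_minus)
qed

lemma arctan_squared_diff_le:
  fixes s t :: real
  assumes "0 \<le> s" "s \<le> t"
  shows "(arctan t)\<^sup>2 - (arctan s)\<^sup>2 \<le> t\<^sup>2 - s\<^sup>2"
proof -
  have d: "\<exists>D. ((\<lambda>x. x - arctan x) has_real_derivative D) (at x) \<and> 0 \<le> D" for x :: real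
    using le_imp_inverse_le[of 1 "1 + x\<^sup>2"] DERIV_diff[OF DERIV_ident DERIV_arctan] by fastforce
  have le: "a - arctan a \<le> b - arctan b" if "a \<le> b" for a b :: real
    using DERIV_nonneg_imp_nondecreasing[of a b "\<lambda>x. x - arctan x"] d that by blast
  have "(arctan t - arctan s) * (arctan t + arctan s) \<le> (t - s) * (t + s)"
    using le[of s t] le[of 0 s] le[of 0 t] assms by (intro mult_mono) auto
  then show ?thesis by (simp add: power2_eq_square algebra_simps)
qed

text \<open>Inserting a = A - 2M + N - l and b = B - 2N + M - l into a^2 + ab + b^2 leaves A^2 + AB
  + B^2 minus three times this expression. Here \<open>l\<close> is -L.\<close>

definition robin_shift :: "real \<Rightarrow> real \<Rightarrow> real \<Rightarrow> real" where
  "robin_shift k x y =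
    (let M = arctan (k/x); N = arctan (k/y); l = arctan (k/(x+y))
     in x*M + y*N + (x+y)*l - (M\<^sup>2 + N\<^sup>2 + l\<^sup>2 - M*N + M*l + N*l))"

text \<open>The quadratic form in the angles equals 3/2 of the sum of squares minus 1/2 of (M + N -
  l)^2, and M + N - l is the single arctan of \<open>arctan_sum_zero_sum\<close>.\<close>

lemma robin_shift_eq:
  assumes "x \<ge> 1" "y \<ge> 1" "0 < k" "k \<le> 1/10"
  shows "robin_shift k x y =
    (x*arctan (k/x) + y*arctan (k/y) + (x+y)*arctan (k/(x+y)))
    - 3/2 * ((arctan (k/x))\<^sup>2 + (arctan (k/y))\<^sup>2 + (arctan (k/(x+y)))\<^sup>2)
    + 1/2 * (arctan (k * (x\<^sup>2 + x*y + y\<^sup>2 + k\<^sup>2) / (x*y*(x+y))))\<^sup>2"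
  unfolding arctan_sum_zero_sum[OF assms, symmetric] robin_shift_def Let_def
  by (simp add: power2_eq_square algebra_simps)

text \<open>As P grows on the level curve, the first sum in \<open>robin_shift_eq\<close> does not
  decrease, and the second, with its weight -3/2, raises the shift by at least (3/4) k^2 q^2 d. The
  last term acts against this, but its loss is below (3/4) k^2 q^2 d.\<close>

lemma robin_shift_strict_mono:
  assumes ge: "x \<ge> 1" "y \<ge> 1" "x' \<ge> 1" "y' \<ge> 1" and k: "0 < k" "k \<le> 1/10"
    and q: "x\<^sup>2 + x*y + y\<^sup>2 = x'\<^sup>2 + x'*y' + y'\<^sup>2"
    and P: "x*y*(x+y) < x'*y'*(x'+y')"
  shows "robin_shift k x y < robin_shift k x' y'"
proof -
  define q where "q = x\<^sup>2 + x*y + y\<^sup>2"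
  define p where "p = x*y*(x+y)"
  define p' where "p' = x'*y'*(x'+y')"
  have pp: "0 < p" "p < p'" using ge P by (auto simp: p_def p'_def)
  have q1: "q \<ge> 1" using ge mult_mono[of 1 x 1 y] unfolding q_def by (smt (verit) zero_le_power2)
  have q2: "x'\<^sup>2 + x'*y' + y'\<^sup>2 = q" using q q_def by simp
  \<comment> \<open>The squares of x, y, x+y have elementary symmetric functions 2q, q^2 and
    p^2.\<close>
  have e1: "x\<^sup>2 + y\<^sup>2 + (x+y)\<^sup>2 = 2*q" "x'\<^sup>2 + y'\<^sup>2 + (x'+y')\<^sup>2 = 2*q"
    using q2 q_def by (simp_all add: power2_eq_square algebra_simps)
  have e2: "x\<^sup>2*y\<^sup>2 + x\<^sup>2*(x+y)\<^sup>2 + y\<^sup>2*(x+y)\<^sup>2 = q\<^sup>2" unfolding q_def by algebra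
  have e2': "x'\<^sup>2*y'\<^sup>2 + x'\<^sup>2*(x'+y')\<^sup>2 + y'\<^sup>2*(x'+y')\<^sup>2 = q\<^sup>2"
    unfolding q2[symmetric] by algebra
  have e3: "x\<^sup>2*y\<^sup>2*(x+y)\<^sup>2 = p\<^sup>2" "x'\<^sup>2*y'\<^sup>2*(x'+y')\<^sup>2 = p'\<^sup>2"
    unfolding p_def p'_def by (simp_all add: power_mult_distrib)
  have p2: "p\<^sup>2 < p'\<^sup>2" using pp by (simp add: power_strict_mono)
  define d where "d = 1/p\<^sup>2 - 1/p'\<^sup>2"
  have d: "d > 0" using p2 pp unfolding d_def by (simp add: frac_less2)
  define \<kappa> where "\<kappa> = k * (q + k\<^sup>2)"
  have kap: "\<kappa> \<ge> 0" using k q1 by (simp add: \<kappa>_def)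
  have k2: "k\<^sup>2 \<le> 1/100" using power_mono[of k "1/10" 2] k by (simp add: power2_eq_square)
  have A: "x*arctan (k/x) + y*arctan (k/y) + (x+y)*arctan (k/(x+y))
      \<le> x'*arctan (k/x') + y'*arctan (k/y') + (x'+y')*arctan (k/(x'+y'))"
    using sum_arctan_mono[of x y "x+y" x' y' "x'+y'" k] ge e1 e2 e2' e3 p2 k by simp
  have B: "q\<^sup>2 * d / 2 * k\<^sup>2 \<le>
      ((arctan (k/x))\<^sup>2 + (arctan (k/y))\<^sup>2 + (arctan (k/(x+y)))\<^sup>2)
      - ((arctan (k/x'))\<^sup>2 + (arctan (k/y'))\<^sup>2 + (arctan (k/(x'+y')))\<^sup>2)"
    using sum_arctan_squared_gap[of x y "x+y" x' y' "x'+y'" k] ge e1 e2 e2' e3 p2 k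
    unfolding d_def by simp
  have "(arctan (\<kappa>/p))\<^sup>2 - (arctan (\<kappa>/p'))\<^sup>2 \<le> (\<kappa>/p)\<^sup>2 - (\<kappa>/p')\<^sup>2"
    using kap pp by (intro arctan_squared_diff_le) (auto intro: divide_left_mono)
  also have "\<dots> = \<kappa>\<^sup>2 * d" unfolding d_def by (simp add: power_divide algebra_simps)
  \<comment> \<open>Since \<open>\<kappa>\<close> is close to k q, the factor 3/2 leaves ample room:
    1.01^2 < 3/2.\<close>
  also have "\<dots> < (3/2 * k\<^sup>2 * q\<^sup>2) * d"
  proof (rule mult_strict_right_mono[OF _ d])
    have "(q + k\<^sup>2)\<^sup>2 \<le> (101/100*q)\<^sup>2" using k2 q1 by (intro power_mono) auto
    also have "\<dots> = 10201/10000 * q\<^sup>2" by (simp add: power_mult_distrib power2_eq_square)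
    also have "\<dots> < 3/2 * q\<^sup>2" using q1 by simp
    finally have "k\<^sup>2 * (q + k\<^sup>2)\<^sup>2 < k\<^sup>2 * (3/2 * q\<^sup>2)" using k by simp
    then show "\<kappa>\<^sup>2 < 3/2 * k\<^sup>2 * q\<^sup>2" by (simp add: \<kappa>_def power_mult_distrib)
  qed
  finally have C: "(arctan (\<kappa>/p))\<^sup>2 - (arctan (\<kappa>/p'))\<^sup>2 < (3/2 * k\<^sup>2 * q\<^sup>2) * d" .
  have "3 * (q\<^sup>2 * d / 2 * k\<^sup>2) = (3/2 * k\<^sup>2 * q\<^sup>2) * d" by simp
  with A B C show ?thesis
    unfolding robin_shift_eq[OF ge(1,2) k] robin_shift_eq[OF ge(3,4) k] q2
      q_def[symmetric] p_def[symmetric] p'_def[symmetric] \<kappa>_def[symmetric]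
    by argo
qed

text \<open>The numbers x, y, -(x+y) are the roots of T^3 - q T + P, with q and P the two
  invariants. So x is among the roots x', y', -(x'+y'), and the sign and order conditions settle
  which.\<close>

lemma cubic_invariants_inj:
  fixes x y x' y' :: real
  assumes pos: "0 < x" "x \<le> y" "0 < x'" "x' \<le> y'"
    and q: "x\<^sup>2 + x*y + y\<^sup>2 = x'\<^sup>2 + x'*y' + y'\<^sup>2"
    and P: "x*y*(x+y) = x'*y'*(x'+y')"
  shows "x = x' \<and> y = y'"
proof -
  have inj: "b = b'" if "0 < a" "0 < b" "0 < b'" "a\<^sup>2 + a*b + b\<^sup>2 = a\<^sup>2 + a*b' + b'\<^sup>2" for a b b' :: real
  proof -
    have "(b - b') * (a + b + b') = 0" using that(4) by algebra
    then show ?thesis using that by simp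
  qed
  have "(x - x') * (x - y') * (x + x' + y') = 0" using q P by algebra
  then consider "x = x'" | "x = y'" using pos by auto
  then show ?thesis
  proof cases
    case 1
    then show ?thesis using inj[of x y y'] q pos by simp
  next
    case 2
    then have "y = x'" using inj[of x y x'] q pos by (simp add: algebra_simps)
    then show ?thesis using 2 pos by simp
  qed
qed

lemma robin_shift_inj:
  assumes "1 \<le> x" "x \<le> y" "1 \<le> x'" "x' \<le> y'" "0 < k" "k \<le> 1/10"
    and "x\<^sup>2 + x*y + y\<^sup>2 = x'\<^sup>2 + x'*y' + y'\<^sup>2" and "robin_shift k x y = robin_shift k x' y'"
  shows "x = x' \<and> y = y'"
  using cubic_invariants_inj[of x y x' y'] robin_shift_strict_mono[of x y x' y' k]
    robin_shift_strict_mono[of x' y' x y k] assms by force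

section \<open>Existence and uniqueness for the reduced system\<close>

definition robin_sol :: "real \<Rightarrow> real \<Rightarrow> real \<Rightarrow> real \<Rightarrow> real \<Rightarrow> bool" where
  "robin_sol k a b A B \<longleftrightarrow> 0 < A \<and> 0 < B \<and>
     A = a + 2 * arctan (k/A) - arctan (k/B) + arctan (k/(A+B)) \<and>
     B = b + 2 * arctan (k/B) - arctan (k/A) + arctan (k/(A+B))"

text \<open>Since arctan(k/x) decreases in x, pairing the angle differences d, e, g with the
  differences of A, B, A+B gives a nonpositive number. By the equations the same number is (d-e)^2 +
  (d+g)^2 + (e+g)^2.\<close>

lemma robin_sol_unique:
  assumes k: "k > 0" and "robin_sol k a b A B" "robin_sol k a b A' B'"
  shows "A = A' \<and> B = B'"
proof -
  define f where "f x = arctan (k/x)" for x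
  have pos: "A > 0" "B > 0" "A' > 0" "B' > 0"
    and eq: "A = a + 2 * f A - f B + f (A+B)" "B = b + 2 * f B - f A + f (A+B)"
      "A' = a + 2 * f A' - f B' + f (A'+B')" "B' = b + 2 * f B' - f A' + f (A'+B')"
    using assms(2,3) by (auto simp: robin_sol_def f_def)
  have mono: "(f x - f y) * (x - y) \<le> 0" if "x > 0" "y > 0" for x y
  proof (cases "x \<le> y")
    case True
    then have "f y \<le> f x" using that k by (auto simp: f_def arctan_le_iff intro: divide_left_mono)
    then show ?thesis using True by (simp add: mult_le_0_iff)
  next
    case False
    then have "f x \<le> f y" using that k by (auto simp: f_def arctan_le_iff intro: divide_left_mono)
    then show ?thesis using False by (simp add: mult_le_0_iff)
  qed
  define d e g where "d = f A - f A'" and "e = f B - f B'" and "g = f (A+B) - f (A'+B')"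
  have dA: "A - A' = 2*d - e + g" using eq(1,3) unfolding d_def e_def g_def by argo
  have dB: "B - B' = 2*e - d + g" using eq(2,4) unfolding d_def e_def g_def by argo
  have "d * (A - A') + e * (B - B') + g * ((A+B) - (A'+B')) \<le> 0"
    using mono[of A A'] mono[of B B'] mono[of "A+B" "A'+B'"] pos
    unfolding d_def e_def g_def by simp
  also have "(A+B) - (A'+B') = (2*d - e + g) + (2*e - d + g)" using dA dB by simp
  finally have "(d - e)\<^sup>2 + (d + g)\<^sup>2 + (e + g)\<^sup>2 \<le> 0"
    unfolding dA dB by (simp add: power2_eq_square algebra_simps)
  then have "(d - e)\<^sup>2 = 0" "(d + g)\<^sup>2 = 0" "(e + g)\<^sup>2 = 0"
    using zero_le_power2[of "d - e"] zero_le_power2[of "d + g"] zero_le_power2[of "e + g"] by linarith+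
  \<comment> \<open>Now d = e = -g, which makes both 2d - e + g and 2e - d + g vanish.\<close>
  then show ?thesis using dA dB by simp
qed

text \<open>One coordinate section of the barrier function. Its derivative 2x + \<beta> - k cot x is
  negative at the left end by \<open>lo\<close> and positive at pi/2 by \<open>hi\<close>, so a
  minimum is interior, and there the derivative is zero.\<close>

lemma log_barrier_minimum:
  fixes k \<beta> \<epsilon> t :: real
  assumes k: "k > 0" and e: "0 < \<epsilon>" "\<epsilon> < pi/2" and lo: "(2*\<epsilon> + \<beta>) * tan \<epsilon> < k" and hi: "pi + \<beta> > 0"
    and t: "\<epsilon> \<le> t" "t \<le> pi/2"
    and min: "\<And>x. \<epsilon> \<le> x \<Longrightarrow> x \<le> pi/2 \<Longrightarrow> t\<^sup>2 + \<beta>*t - k * ln (sin t) \<le> x\<^sup>2 + \<beta>*x - k * ln (sin x)"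
  shows "t < pi/2 \<and> (2*t + \<beta>) * tan t = k"
proof -
  define g where "g x = x\<^sup>2 + \<beta>*x - k * ln (sin x)" for x
  have sin: "sin x > 0" if "\<epsilon> \<le> x" "x \<le> pi/2" for x
    using that e by (intro sin_gt_zero) auto
  have d: "(g has_real_derivative 2*x + \<beta> - k * (cos x / sin x)) (at x)" if "\<epsilon> \<le> x" "x \<le> pi/2" for x
    unfolding g_def using sin[OF that] by (auto intro!: derivative_eq_intros)
  have "t \<noteq> pi/2"
  proof
    assume "t = pi/2"
    then have "cos t = 0" by (simp only: cos_pi_half)
    moreover have "2*t = pi" using \<open>t = pi/2\<close> by simp
    ultimately have "\<exists>d>0. \<forall>h>0. h < d \<longrightarrow> g (t - h) < g t"
      using DERIV_pos_inc_left[OF d[OF t]] hi cos_pi_half by auto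
    then obtain d where "d > 0" "\<And>h. 0 < h \<Longrightarrow> h < d \<Longrightarrow> g (t - h) < g t" by blast
    moreover define h where "h = min d (t - \<epsilon>) / 2"
    ultimately have "0 < h" "h < d" "\<epsilon> \<le> t - h" unfolding h_def using \<open>t = pi/2\<close> e
      by (auto simp: min_def field_simps split: if_splits)
    moreover from this have "g t \<le> g (t - h)" using min[of "t - h"] t unfolding g_def by simp
    ultimately show False using \<open>\<And>h. 0 < h \<Longrightarrow> h < d \<Longrightarrow> g (t - h) < g t\<close>[of h] by simp
  qed
  moreover have "t \<noteq> \<epsilon>"
  proof
    assume "t = \<epsilon>"
    have "cos \<epsilon> > 0" using e by (intro cos_gt_zero) auto
    then have "2*\<epsilon> + \<beta> - k * (cos \<epsilon> / sin \<epsilon>) < 0"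
      using lo sin[of \<epsilon>] e by (simp add: tan_def field_simps)
    then have "\<exists>d>0. \<forall>h>0. h < d \<longrightarrow> g (t + h) < g t"
      using DERIV_neg_dec_right[OF d[OF t]] \<open>t = \<epsilon>\<close> by simp
    then obtain d where "d > 0" "\<And>h. 0 < h \<Longrightarrow> h < d \<Longrightarrow> g (t + h) < g t" by blast
    moreover define h where "h = min d (pi/2 - t) / 2"
    ultimately have "0 < h" "h < d" "t + h \<le> pi/2" unfolding h_def using \<open>t = \<epsilon>\<close> e
      by (auto simp: min_def field_simps split: if_splits)
    moreover from this have "g t \<le> g (t + h)" using min[of "t + h"] t unfolding g_def by simp
    ultimately show False using \<open>\<And>h. 0 < h \<Longrightarrow> h < d \<Longrightarrow> g (t + h) < g t\<close>[of h] by simp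
  qed
  ultimately have t': "\<epsilon> < t" "t < pi/2" using t by auto
  have "2*t + \<beta> - k * (cos t / sin t) = 0"
  proof (rule DERIV_local_min[OF d[OF t]])
    show "0 < min (t - \<epsilon>) (pi/2 - t)" using t' by simp
    show "\<forall>y. \<bar>t - y\<bar> < min (t - \<epsilon>) (pi/2 - t) \<longrightarrow> g t \<le> g y"
      using min unfolding g_def by (auto simp: abs_less_iff)
  qed
  moreover have "cos t > 0" using t' e by (intro cos_gt_zero) auto
  ultimately show ?thesis using t' sin[OF t] by (simp add: tan_def field_simps)
qed

lemma mult_tan_eq_imp_arctan:
  fixes k w X :: real
  assumes k: "0 < k" and w: "0 \<le> w" "w < pi/2" and eq: "X * tan w = k"
  shows "0 < X \<and> arctan (k/X) = w"
proof -
  have "w \<noteq> 0" using eq k by auto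
  then have "tan w > 0" using w tan_gt_zero by simp
  then have "X > 0" using eq k by (metis zero_less_mult_pos2)
  then have "k / X = tan w" using eq by (simp add: field_simps)
  then show ?thesis using w \<open>X > 0\<close> arctan_tan[of w] by simp
qed

text \<open>Compactness gives a minimum of the barrier function \<open>F\<close> on the cube
  [\<epsilon>, pi/2]^3. Each coordinate then minimises its own section, where
  \<open>log_barrier_minimum\<close> yields one equation of the system.\<close>

lemma robin_sol_exists:
  assumes k: "k > 0" and ab: "a \<ge> 0" "b \<ge> 0"
  shows "\<exists>A B. robin_sol k a b A B"
proof -
  \<comment> \<open>Chosen so that (a + b + 2 pi) tan \<epsilon> = k/2; as the three linear
    coefficients are at most a + b + pi and 2\<epsilon> < pi, one cube serves all
    coordinates.\<close>
  define \<delta> where "\<delta> = k / (2 * (a + b + 2*pi))"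
  define \<epsilon> where "\<epsilon> = arctan \<delta>"
  have s: "a + b + 2*pi > 0" using ab pi_gt_zero by linarith
  have del: "\<delta> > 0" using k s by (simp add: \<delta>_def)
  have e: "0 < \<epsilon>" "\<epsilon> < pi/2" using del arctan_ubound by (auto simp: \<epsilon>_def)
  have lo: "(2*\<epsilon> + \<beta>) * tan \<epsilon> < k" if "\<beta> \<le> a + b + pi" for \<beta>
  proof -
    have "(2*\<epsilon> + \<beta>) * tan \<epsilon> \<le> (a + b + 2*pi) * \<delta>"
      using del e that unfolding \<epsilon>_def tan_arctan by (intro mult_right_mono) auto
    also have "\<dots> = k/2" using s unfolding \<delta>_def by (simp add: divide_simps)
    finally show ?thesis using k by simp
  qed
  define K where "K = {\<epsilon>..pi/2} \<times> {\<epsilon>..pi/2} \<times> {\<epsilon>..pi/2}"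
  define F where "F = (\<lambda>(x::real, y::real, z::real). x\<^sup>2 + y\<^sup>2 + z\<^sup>2 - x*y + x*z + y*z + a*x + b*y + (a+b)*z
    - k * (ln (sin x) + ln (sin y) + ln (sin z)))"
  have "compact K" unfolding K_def by (intro compact_Times) auto
  moreover have "K \<noteq> {}" unfolding K_def using e by auto
  moreover have "continuous_on K F"
  proof -
    have "sin x \<noteq> 0" if "\<epsilon> \<le> x" "x \<le> pi/2" for x
      using sin_gt_zero[of x] that e by auto
    then show ?thesis unfolding K_def F_def case_prod_unfold
      by (intro continuous_intros) auto
  qed
  ultimately obtain p where p: "p \<in> K" "\<And>y. y \<in> K \<Longrightarrow> F p \<le> F y"
    using continuous_attains_inf[of K F] by blast
  obtain M N l where p_eq: "p = (M, N, l)" by (cases p)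
  have box: "\<epsilon> \<le> M" "M \<le> pi/2" "\<epsilon> \<le> N" "N \<le> pi/2" "\<epsilon> \<le> l" "l \<le> pi/2"
    using p(1) unfolding p_eq K_def by auto
  have M: "M < pi/2 \<and> (2*M + (a + l - N)) * tan M = k"
  proof (rule log_barrier_minimum[OF k e lo])
    show "M\<^sup>2 + (a+l-N)*M - k * ln (sin M) \<le> x\<^sup>2 + (a+l-N)*x - k * ln (sin x)"
      if "\<epsilon> \<le> x" "x \<le> pi/2" for x
      using p(2)[of "(x, N, l)"] box that unfolding p_eq K_def F_def by (simp add: algebra_simps)
  qed (use box ab e in auto)
  have N: "N < pi/2 \<and> (2*N + (b + l - M)) * tan N = k"
  proof (rule log_barrier_minimum[OF k e lo])
    show "N\<^sup>2 + (b+l-M)*N - k * ln (sin N) \<le> x\<^sup>2 + (b+l-M)*x - k * ln (sin x)"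
      if "\<epsilon> \<le> x" "x \<le> pi/2" for x
      using p(2)[of "(M, x, l)"] box that unfolding p_eq K_def F_def by (simp add: algebra_simps)
  qed (use box ab e in auto)
  have l: "l < pi/2 \<and> (2*l + (a + b + M + N)) * tan l = k"
  proof (rule log_barrier_minimum[OF k e lo])
    show "l\<^sup>2 + (a+b+M+N)*l - k * ln (sin l) \<le> x\<^sup>2 + (a+b+M+N)*x - k * ln (sin x)"
      if "\<epsilon> \<le> x" "x \<le> pi/2" for x
      using p(2)[of "(M, N, x)"] box that unfolding p_eq K_def F_def by (simp add: algebra_simps)
  qed (use box ab e in auto)
  define A B where "A = 2*M + (a + l - N)" and "B = 2*N + (b + l - M)"
  have C: "A + B = 2*l + (a + b + M + N)" unfolding A_def B_def by simp
  have "robin_sol k a b A B"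
    using mult_tan_eq_imp_arctan[OF k, of M A] mult_tan_eq_imp_arctan[OF k, of N B]
      mult_tan_eq_imp_arctan[OF k, of l "A+B"] M N l box e C
    unfolding robin_sol_def A_def[symmetric] B_def[symmetric] C[symmetric]
    by (auto simp: A_def B_def)
  then show ?thesis by blast
qed

section \<open>Passage between the system for (L, M, N) and the reduced system\<close>

text \<open>The three brackets add up to zero, so with the second and third named A and B the first
  is -(A+B). A positive right side and the ranges of the angles force A, B, A+B > 0 and let arctan
  invert tan.\<close>

lemma robin_sys_iff:
  assumes k: "3 * r * \<sigma> > 0"
  shows "robin_sys r m n \<sigma> (L, M, N) \<longleftrightarrow>
    (\<exists>A B. robin_sol (3*r*\<sigma>) (real m * pi) (real n * pi) A B \<and>
      M = arctan (3*r*\<sigma>/A) \<and> N = arctan (3*r*\<sigma>/B) \<and> L = - arctan (3*r*\<sigma>/(A+B)))"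
    (is "?l \<longleftrightarrow> ?r")
proof
  let ?k = "3*r*\<sigma>"
  assume ?l
  define A B where "A = 2*M - N - L + real m * pi" and "B = 2*N - L - M + real n * pi"
  have C: "2*L - M - N - (real m + real n) * pi = - (A + B)" unfolding A_def B_def by (simp add: algebra_simps)
  have h: "-pi/2 < L" "L \<le> 0" "0 \<le> M" "M < pi/2" "0 \<le> N" "N < pi/2"
    "- (A + B) * tan L = ?k" "A * tan M = ?k" "B * tan N = ?k"
    using \<open>?l\<close> unfolding robin_sys_def prod.case C A_def[symmetric] B_def[symmetric] by blast+
  note arc = mult_tan_eq_imp_arctan[OF k]
  have "(A + B) * tan (- L) = ?k" using h(7) unfolding tan_minus by argo
  then have "0 < A + B \<and> arctan (?k/(A+B)) = - L" using arc[of "- L" "A + B"] h(1,2) by simp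
  moreover have "0 < A \<and> arctan (?k/A) = M" "0 < B \<and> arctan (?k/B) = N"
    using arc[OF h(3,4,8)] arc[OF h(5,6,9)] by simp_all
  ultimately have "robin_sol ?k (real m * pi) (real n * pi) A B \<and>
      M = arctan (?k/A) \<and> N = arctan (?k/B) \<and> L = - arctan (?k/(A+B))"
    unfolding robin_sol_def by (auto simp: A_def B_def)
  then show ?r by blast
next
  let ?k = "3*r*\<sigma>"
  assume ?r
  then obtain A B where h: "robin_sol ?k (real m * pi) (real n * pi) A B"
    and MNL: "M = arctan (?k/A)" "N = arctan (?k/B)" "L = - arctan (?k/(A+B))" by blast
  have pos: "0 < A" "0 < B" and A: "A = 2*M - N - L + real m * pi" and B: "B = 2*N - L - M + real n * pi"
    using h unfolding robin_sol_def MNL by auto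
  have C: "2*L - M - N - (real m + real n) * pi = - (A + B)"
    using A B by (simp add: algebra_simps)
  have "- (A + B) * tan L = ?k" "A * tan M = ?k" "B * tan N = ?k"
    using pos unfolding MNL by (auto simp: tan_minus tan_arctan field_simps)
  moreover have "-pi/2 < L \<and> L \<le> 0 \<and> 0 \<le> M \<and> M < pi/2 \<and> 0 \<le> N \<and> N < pi/2"
    using pos k arctan_ubound unfolding MNL by (simp add: less_imp_le)
  ultimately show ?l unfolding robin_sys_def prod.case C A[symmetric] B[symmetric] by blast
qed

text \<open>Uniqueness evaluates the \<open>THE\<close> in \<open>robin_LMN\<close>; then \<mu> =
  A/pi and \<nu> = B/pi, and pi^2 cancels.\<close>

lemma robin_Lambda_eq:
  assumes "r > 0" "\<sigma> > 0" "robin_sol (3*r*\<sigma>) (real m * pi) (real n * pi) A B"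
  shows "robin_Lambda r m n \<sigma> = 4 / (27 * r\<^sup>2) * (A\<^sup>2 + A*B + B\<^sup>2)"
proof -
  let ?k = "3*r*\<sigma>"
  have k: "?k > 0" using assms by simp
  define M N L where MNL: "M = arctan (?k/A)" "N = arctan (?k/B)" "L = - arctan (?k/(A+B))"
  have LMN: "robin_LMN r m n \<sigma> = (L, M, N)"
    unfolding robin_LMN_def
  proof (rule the_equality)
    show "robin_sys r m n \<sigma> (L, M, N)" using assms(3) MNL robin_sys_iff[OF k] by blast
    show "p = (L, M, N)" if "robin_sys r m n \<sigma> p" for p
      using that robin_sol_unique[OF k assms(3)] robin_sys_iff[OF k] MNL by (cases p) auto
  qed
  have "2*M - N - L + real m * pi = A" "2*N - L - M + real n * pi = B"
    using assms(3) unfolding robin_sol_def MNL by auto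
  then have \<mu>\<nu>: "(2*M - N - L) / pi + real m = A / pi" "(2*N - L - M) / pi + real n = B / pi"
    by (simp_all add: field_simps)
  show ?thesis
    unfolding robin_Lambda_def LMN prod.case Let_def \<mu>\<nu> using assms(1)
    by (simp add: field_simps power2_eq_square)
qed

section \<open>Bounds for the shift and its first order in k\<close>

lemma arctan_bounds:
  fixes t :: real
  assumes "t \<ge> 0"
  shows "arctan t \<le> t" "t - t^3/3 \<le> arctan t"
proof -
  have "0 \<le> (\<lambda>t. arctan t - (t - t^3/3)) t"
  proof (rule has_derivative_nonneg_imp_nonneg[where g = "\<lambda>t. arctan t - (t - t^3/3)" and s = t and g' = "\<lambda>x. x^4 / (1 + x\<^sup>2)"])
    fix x :: real
    have p: "1 + x\<^sup>2 > 0" by (simp add: add_pos_nonneg)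
    have "((\<lambda>t. arctan t - (t - t^3/3)) has_real_derivative inverse (1 + x\<^sup>2) - (1 - x\<^sup>2)) (at x)"
      by (auto intro!: derivative_eq_intros)
    also have "inverse (1 + x\<^sup>2) - (1 - x\<^sup>2) = x^4 / (1 + x\<^sup>2)"
      using p by (simp add: field_simps power4_eq_xxxx power2_eq_square)
    finally show "((\<lambda>t. arctan t - (t - t^3/3)) has_real_derivative x^4 / (1 + x\<^sup>2)) (at x)" .
    show "0 \<le> x^4 / (1 + x\<^sup>2)" using p by simp
  qed (use assms in auto)
  then show "t - t^3/3 \<le> arctan t" by simp
  have "(arctan t)\<^sup>2 - (arctan 0)\<^sup>2 \<le> t\<^sup>2 - 0\<^sup>2" using assms by (intro arctan_squared_diff_le) auto
  then have "(arctan t)\<^sup>2 \<le> t\<^sup>2" by simp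
  then show "arctan t \<le> t" using assms by (rule power2_le_imp_le)
qed

lemma mult_arctan_divide_le:
  fixes x k :: real
  assumes "x > 0" "k > 0"
  shows "x * arctan (k/x) \<le> k"
  using arctan_bounds(1)[of "k/x"] assms by (simp add: field_simps)

lemma mult_arctan_divide_ge:
  fixes x k :: real
  assumes "x \<ge> 1" "k > 0"
  shows "k - k^3/3 \<le> x * arctan (k/x)"
proof -
  have "k - k^3/3 \<le> k - k^3/(3*x\<^sup>2)"
    using assms by (intro diff_left_mono frac_le) (auto simp: one_le_power)
  also have "\<dots> = x * (k/x - (k/x)^3/3)" using assms
    by (simp add: field_simps power3_eq_cube power2_eq_square)
  also have "\<dots> \<le> x * arctan (k/x)" using arctan_bounds(2)[of "k/x"] assms by (intro mult_left_mono) auto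
  finally show ?thesis .
qed

lemma robin_form_eq:
  fixes M N l :: real
  shows "M\<^sup>2 + N\<^sup>2 + l\<^sup>2 - M*N + M*l + N*l = ((M-N)\<^sup>2 + (M+l)\<^sup>2 + (N+l)\<^sup>2) / 2"
  by (simp add: power2_eq_square algebra_simps)

lemma robin_sol_quadratic:
  assumes "robin_sol k a b A B"
  shows "A\<^sup>2 + A*B + B\<^sup>2 = a\<^sup>2 + a*b + b\<^sup>2 + 3 * robin_shift k A B"
proof -
  define M N l where MNl: "M = arctan (k/A)" "N = arctan (k/B)" "l = arctan (k/(A+B))"
  have ab: "a = A - 2*M + N - l" "b = B - 2*N + M - l"
    using assms unfolding robin_sol_def MNl by linarith+
  show ?thesis unfolding robin_shift_def Let_def MNl[symmetric] ab
    by (simp add: power2_eq_square algebra_simps)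
qed

lemma robin_shift_le:
  assumes "k > 0" "A > 0" "B > 0"
  shows "robin_shift k A B \<le> 3*k"
  using mult_arctan_divide_le[of A k] mult_arctan_divide_le[of B k] mult_arctan_divide_le[of "A+B" k] assms
  unfolding robin_shift_def Let_def robin_form_eq by (smt (verit) zero_le_power2 divide_nonneg_pos)

text \<open>Writing A and B through a and b turns the linear terms into a M + b N + (a+b) l plus
  twice the quadratic form, so the form survives with a plus sign.\<close>

lemma robin_shift_nonneg:
  assumes sol: "robin_sol k a b A B" and k: "k > 0" and ab: "a \<ge> 0" "b \<ge> 0"
  shows "0 \<le> robin_shift k A B"
proof -
  define M N l where MNl: "M = arctan (k/A)" "N = arctan (k/B)" "l = arctan (k/(A+B))"
  have ab': "a = A - 2*M + N - l" "b = B - 2*N + M - l"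
    using sol unfolding robin_sol_def MNl by linarith+
  have pos: "M \<ge> 0" "N \<ge> 0" "l \<ge> 0" using sol k unfolding robin_sol_def MNl by auto
  have "robin_shift k A B = a*M + b*N + (a+b)*l + ((M-N)\<^sup>2 + (M+l)\<^sup>2 + (N+l)\<^sup>2) / 2"
    unfolding robin_shift_def Let_def MNl[symmetric] ab' by (simp add: power2_eq_square field_simps)
  then show ?thesis using pos ab by simp
qed

text \<open>Subtracting the equations gives A - B = a - b + 3 (M - N) with M, N the angles of A, B;
  A > B would make M \<le> N and the right side nonpositive.\<close>

lemma robin_sol_mono:
  assumes "robin_sol k a b A B" "k > 0" "a \<le> b"
  shows "A \<le> B"
proof (rule ccontr)
  assume "\<not> A \<le> B"
  then have "arctan (k/A) \<le> arctan (k/B)"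
    using assms by (auto simp: robin_sol_def arctan_le_iff intro: divide_left_mono)
  then show False using assms \<open>\<not> A \<le> B\<close> unfolding robin_sol_def by linarith
qed

lemma robin_sol_ge_one:
  assumes "robin_sol k a b A B" "k > 0" "pi \<le> a" "a \<le> b"
  shows "1 \<le> A" "1 \<le> B"
proof -
  have "0 < arctan (k/A)" "arctan (k/B) < pi/2" "0 < arctan (k/(A+B))"
    using assms arctan_ubound by (auto simp: robin_sol_def)
  then show "1 \<le> A" using assms pi_ge_two unfolding robin_sol_def by linarith
  then show "1 \<le> B" using robin_sol_mono[OF assms(1,2,4)] by simp
qed

text \<open>With a = 0 the equation forces A \<le> 2M, while A tan M = k; so M^2 is of order k
  rather than k^2, and the quadratic form lowers the shift at first order: 3/4 M^2 \<ge> 3/16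
  k.\<close>

lemma robin_shift_axis:
  assumes sol: "robin_sol k 0 b A B" and k: "0 < k" "k \<le> 1"
  shows "robin_shift k A B \<le> 3*k - 3/16*k"
proof -
  define M N l where MNl: "M = arctan (k/A)" "N = arctan (k/B)" "l = arctan (k/(A+B))"
  have pos: "A > 0" "B > 0" and A: "A = 2*M - N + l" using sol unfolding robin_sol_def MNl by linarith+
  have Mpos: "M > 0" using pos k by (simp add: MNl)
  have "l \<le> N" unfolding MNl using pos k by (auto simp: arctan_le_iff intro: divide_left_mono)
  then have A2: "A \<le> 2*M" using A by linarith
  have "k/4 \<le> M\<^sup>2"
  proof (cases "k \<le> A")
    case True
    define t where "t = k/A"
    have "0 \<le> t" "t \<le> 1" using True pos k by (auto simp: t_def)
    then have "t - t^3/3 \<le> M" "t^3 \<le> t"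
      using arctan_bounds(2)[of t] power_decreasing[of 1 3 t] by (auto simp: t_def MNl)
    then have "t/2 \<le> M" using \<open>0 \<le> t\<close> by linarith
    then have "k/A/2 \<le> M" by (simp add: t_def)
    then have "k \<le> M * (2*A)" using pos by (simp add: field_simps)
    also have "\<dots> \<le> M * (4*M)" using A2 Mpos by (intro mult_left_mono) auto
    finally show ?thesis by (simp add: power2_eq_square)
  next
    case False
    then have "1 < k/A" using pos by simp
    then have "pi/4 < M" unfolding MNl arctan_one[symmetric] by (simp add: arctan_less_iff)
    then have "1/2 \<le> M" using pi_ge_two by linarith
    then have "(1/2)\<^sup>2 \<le> M\<^sup>2" by (intro power_mono) auto
    then show ?thesis using k by (simp add: power2_eq_square)
  qed
  \<comment> \<open>Completing the square in N costs M^2/4.\<close>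
  moreover have "3/4 * M\<^sup>2 \<le> M\<^sup>2 + N\<^sup>2 + l\<^sup>2 - M*N + M*l + N*l"
  proof -
    have "l \<ge> 0" "N \<ge> 0" using pos k by (auto simp: MNl)
    then have "0 \<le> (N - M/2)\<^sup>2 + l\<^sup>2 + M*l + N*l" using Mpos by simp
    also have "\<dots> = M\<^sup>2 + N\<^sup>2 + l\<^sup>2 - M*N + M*l + N*l - 3/4 * M\<^sup>2"
      by (simp add: power2_eq_square algebra_simps)
    finally show ?thesis by simp
  qed
  moreover have "A*M \<le> k" "B*N \<le> k" "(A+B)*l \<le> k"
    using pos k by (auto simp: MNl intro!: mult_arctan_divide_le)
  ultimately show ?thesis unfolding robin_shift_def Let_def MNl[symmetric] by linarith
qed

text \<open>For A, B \<ge> 1 all angles are at most k, so the shift is 3k up to order k^2. The loss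
  is at most 5k^2 + k^3 \<le> 6k/100, which stays above the threshold of
  \<open>robin_shift_axis\<close>.\<close>

lemma robin_shift_interior:
  assumes "A \<ge> 1" "B \<ge> 1" and k: "0 < k" "k \<le> 1/100"
  shows "3*k - 3/16*k < robin_shift k A B"
proof -
  define M N l where MNl: "M = arctan (k/A)" "N = arctan (k/B)" "l = arctan (k/(A+B))"
  have le: "0 \<le> arctan (k/x)" "arctan (k/x) \<le> k" if "x \<ge> 1" for x
  proof -
    have "k/x \<le> k" using that k by (simp add: divide_le_eq mult_le_cancel_left1)
    then show "0 \<le> arctan (k/x)" "arctan (k/x) \<le> k"
      using arctan_bounds(1)[of "k/x"] that k by auto
  qed
  have MNl_le: "0 \<le> M" "M \<le> k" "0 \<le> N" "N \<le> k" "0 \<le> l" "l \<le> k"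
    using le assms by (auto simp: MNl)
  have "M\<^sup>2 \<le> k\<^sup>2" "N\<^sup>2 \<le> k\<^sup>2" "l\<^sup>2 \<le> k\<^sup>2" using MNl_le by (auto intro: power_mono)
  moreover have "M*l \<le> k\<^sup>2" "N*l \<le> k\<^sup>2" "0 \<le> M*N"
    using MNl_le k unfolding power2_eq_square by (auto intro!: mult_mono)
  ultimately have quad: "M\<^sup>2 + N\<^sup>2 + l\<^sup>2 - M*N + M*l + N*l \<le> 5*k\<^sup>2" by linarith
  have k2: "k\<^sup>2 \<le> k/100" using k unfolding power2_eq_square by (simp add: field_simps)
  have k3: "k^3 \<le> k/100"
  proof -
    have "k^3 \<le> k^2" using k by (intro power_decreasing) auto
    then show ?thesis using k2 by simp
  qed
  have "k - k^3/3 \<le> A*M" "k - k^3/3 \<le> B*N" "k - k^3/3 \<le> (A+B)*l"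
    unfolding MNl using assms by (intro mult_arctan_divide_ge; simp)+
  then show ?thesis
    using quad k2 k3 k unfolding robin_shift_def Let_def MNl[symmetric] by linarith
qed

section \<open>Absence of coincidences\<close>

text \<open>Equal values make pi^2 times the integer \<open>Q\<close> equal to three times a
  difference of shifts in [0, 3k]. This is at most 9k < 1 in size, so \<open>Q\<close> is 0 and the
  shifts agree as well.\<close>

lemma robin_sol_no_coincidence:
  fixes m n m' n' :: nat
  assumes k: "0 < k" "k \<le> 1/100" and le: "m \<le> n" "m' \<le> n'"
    and sol: "robin_sol k (real m * pi) (real n * pi) A B"
    and sol': "robin_sol k (real m' * pi) (real n' * pi) A' B'"
    and eq: "A\<^sup>2 + A*B + B\<^sup>2 = A'\<^sup>2 + A'*B' + B'\<^sup>2"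
  shows "m = m' \<and> n = n'"
proof -
  define Q where "Q = int (m^2 + m*n + n^2) - int (m'^2 + m'*n' + n'^2)"
  have pos: "A > 0" "B > 0" "A' > 0" "B' > 0" using sol sol' by (auto simp: robin_sol_def)
  note bnd = robin_shift_nonneg[OF sol k(1)] robin_shift_le[OF k(1) pos(1,2)]
    robin_shift_nonneg[OF sol' k(1)] robin_shift_le[OF k(1) pos(3,4)]
  have Q: "pi\<^sup>2 * real_of_int Q = 3 * (robin_shift k A' B' - robin_shift k A B)"
    using robin_sol_quadratic[OF sol] robin_sol_quadratic[OF sol'] eq unfolding Q_def
    by (simp add: power_mult_distrib power2_eq_square algebra_simps)
  have "\<bar>pi\<^sup>2 * real_of_int Q\<bar> \<le> 9*k" unfolding Q using bnd by simp
  also have "\<dots> < 1" using k by simp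
  finally have "pi\<^sup>2 * \<bar>real_of_int Q\<bar> < 1" by (simp add: abs_mult)
  moreover have "1 \<le> pi\<^sup>2" using pi_ge_two by (simp add: one_le_power)
  then have "\<bar>real_of_int Q\<bar> \<le> pi\<^sup>2 * \<bar>real_of_int Q\<bar>" by (simp add: mult_le_cancel_right1)
  ultimately have "\<bar>real_of_int Q\<bar> < 1" by simp
  then have Q0: "Q = 0" by linarith
  then have shift: "robin_shift k A B = robin_shift k A' B'" using Q by simp
  have Qn: "m^2 + m*n + n^2 = m'^2 + m'*n' + n'^2" using Q0 unfolding Q_def by linarith
  have int: "1 \<le> A \<and> 1 \<le> B" if "m \<ge> 1" "m \<le> n" "robin_sol k (real m * pi) (real n * pi) A B"
    for m n :: nat and A B
    using robin_sol_ge_one[OF that(3) k(1)] that pi_gt_zero by (simp add: mult_right_mono)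
  consider "m = 0" "m' = 0" | "m = 0" "m' \<ge> 1" | "m \<ge> 1" "m' = 0" | "m \<ge> 1" "m' \<ge> 1" by linarith
  then show ?thesis
  proof cases
    case 1
    then show ?thesis using Qn by simp
  next
    case 2
    \<comment> \<open>The two shifts lie on opposite sides of 3k - 3k/16.\<close>
    then have "robin_shift k A B \<le> 3*k - 3/16*k" using robin_shift_axis[of k _ A B] sol k by simp
    then show ?thesis using robin_shift_interior[of A' B' k] int[OF _ le(2) sol'] 2 k shift by simp
  next
    case 3
    then have "robin_shift k A' B' \<le> 3*k - 3/16*k" using robin_shift_axis[of k _ A' B'] sol' k by simp
    then show ?thesis using robin_shift_interior[of A B k] int[OF _ le(1) sol] 3 k shift by simp
  next
    case 4
    have "A \<le> B" "A' \<le> B'"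
      using robin_sol_mono[OF sol k(1)] robin_sol_mono[OF sol' k(1)] le by (simp_all add: mult_right_mono)
    then have "A = A' \<and> B = B'"
      using robin_shift_inj[of A B A' B' k] int[OF 4(1) le(1) sol] int[OF 4(2) le(2) sol'] eq shift k
      by simp
    \<comment> \<open>The reduced system recovers (a, b) from (A, B), so equal solutions come from
      the same integers.\<close>
    then have "robin_sol k (real m' * pi) (real n' * pi) A B" using sol' by simp
    then have "real m * pi = real m' * pi" "real n * pi = real n' * pi"
      using sol unfolding robin_sol_def by linarith+
    then show ?thesis by simp
  qed
qed

theorem theorem1p5:
  fixes r :: real
  assumes "r > 0"
  shows "\<exists>\<sigma>0 > 0. \<forall>\<sigma>. 0 < \<sigma> \<and> \<sigma> < \<sigma>0 \<longrightarrow>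
           (\<forall>m n m' n' :: nat. m \<le> n \<and> m' \<le> n' \<and> (m, n) \<noteq> (m', n') \<longrightarrow>
              robin_Lambda r m n \<sigma> \<noteq> robin_Lambda r m' n' \<sigma>)"
proof (intro exI[of _ "1 / (300 * r)"] conjI allI impI notI)
  show "1 / (300 * r) > 0" using assms by simp
next
  fix \<sigma> :: real and m n m' n' :: nat
  assume s: "0 < \<sigma> \<and> \<sigma> < 1 / (300 * r)" and le: "m \<le> n \<and> m' \<le> n' \<and> (m, n) \<noteq> (m', n')"
    and eq: "robin_Lambda r m n \<sigma> = robin_Lambda r m' n' \<sigma>"
  \<comment> \<open>The bound 1/(300 r) on \<sigma> amounts to k < 1/100, within the range of
    \<open>robin_sol_no_coincidence\<close>.\<close>
  have k: "0 < 3*r*\<sigma>" "3*r*\<sigma> \<le> 1/100" using s assms by (simp_all add: field_simps)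
  obtain A B where sol: "robin_sol (3*r*\<sigma>) (real m * pi) (real n * pi) A B"
    using robin_sol_exists[OF k(1)] by force
  obtain A' B' where sol': "robin_sol (3*r*\<sigma>) (real m' * pi) (real n' * pi) A' B'"
    using robin_sol_exists[OF k(1)] by force
  have "A\<^sup>2 + A*B + B\<^sup>2 = A'\<^sup>2 + A'*B' + B'\<^sup>2"
    using eq robin_Lambda_eq[OF assms _ sol] robin_Lambda_eq[OF assms _ sol'] s assms by simp
  then show False using robin_sol_no_coincidence[OF k _ _ sol sol'] le by simp
qed

end
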